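(* Assume $n$ is large enough and $10\le c\le\log n$. In the noisy model with parameter $\gamma$ there is a randomized algorithm for FINDMIN on $n$ elements (with parameter $c$) that has query complexity $\frac{3cn}{\gamma^2}$ and solves FINDMIN with probability at least $1-e^{-\Omega(c)}$.
   Context: Setting. The input is a set of $n$ elements with an unknown total order, presented in uniformly random order (the elements are a priori indistinguishable). FINDMIN: output the minimum element. Algorithms access the order only through pairwise comparison queries, which may be made adaptively in any number of rounds and with repetition (resampling). Query complexity is the total number of comparisons. Noisy model with parameter $\gamma$: each comparison independently returns the correct answer with probability $1/2+\gamma/2$ and the incorrect answer with probability $1/2-\gamma/2$. The success probability is over the random input order, the comparison outcomes and the algorithm's randomness. *)

theory Defs
  imports "HOL-Probability.Probability" "HOL-Combinatorics.Multiset_Permutations"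
begin

text \<open>
  Deterministic adaptive comparison algorithms are decision trees.  The algorithm sees only the
  positions \<open>0, \<dots>, n - 1\<close> of the input list: \<open>Query i j k\<close> asks whether the element at position
  \<open>i\<close> is smaller than the one at position \<open>j\<close> and continues with \<open>k\<close> applied to the (possibly
  wrong) answer; \<open>Output i\<close> announces the element at position \<open>i\<close> as the minimum.
\<close>

datatype comp_tree = Output nat | Query nat nat "bool \<Rightarrow> comp_tree"

primrec valid_tree :: "nat \<Rightarrow> comp_tree \<Rightarrow> bool" where
  "valid_tree n (Output i) \<longleftrightarrow> i < n"
| "valid_tree n (Query i j k) \<longleftrightarrow> i < n \<and> j < n \<and> i \<noteq> j \<and> (\<forall>b. valid_tree n (k b))"

primrec num_queries :: "comp_tree \<Rightarrow> nat" where
  "num_queries (Output i) = 0"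
| "num_queries (Query i j k) = Suc (max (num_queries (k True)) (num_queries (k False)))"

definition noisy_answer :: "real \<Rightarrow> bool \<Rightarrow> bool pmf" where
  "noisy_answer \<gamma> b =
     map_pmf (\<lambda>correct. if correct then b else \<not> b) (bernoulli_pmf (1 / 2 + \<gamma> / 2))"

text \<open>
  Every query draws fresh noise, so repeating a comparison resamples its answer.  The
  argument \<open>le\<close> gives the true order on positions; valid trees never query \<open>i = j\<close>.
\<close>

primrec run_tree :: "real \<Rightarrow> (nat \<Rightarrow> nat \<Rightarrow> bool) \<Rightarrow> comp_tree \<Rightarrow> nat pmf" where
  "run_tree \<gamma> le (Output i) = return_pmf i"
| "run_tree \<gamma> le (Query i j k) =
     bind_pmf (noisy_answer \<gamma> (le i j)) (\<lambda>b. run_tree \<gamma> le (k b))"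

text \<open>A randomized algorithm is a probability distribution over decision trees.\<close>

type_synonym rand_alg = "comp_tree pmf"

definition comparison_algorithm :: "nat \<Rightarrow> rand_alg \<Rightarrow> bool" where
  "comparison_algorithm n A \<longleftrightarrow> (\<forall>t\<in>set_pmf A. valid_tree n t)"

text \<open>Query complexity is worst case: over the internal randomness, the input and the noise.\<close>

definition query_complexity_le :: "rand_alg \<Rightarrow> real \<Rightarrow> bool" where
  "query_complexity_le A q \<longleftrightarrow> (\<forall>t\<in>set_pmf A. real (num_queries t) \<le> q)"

text \<open>
  The elements are named \<open>0, \<dots>, n - 1\<close>, with an arbitrary linear order \<open>r\<close> on the names
  that is unrelated to the order of the natural numbers, and \<open>xs\<close> lists them in uniformly
  random order.  The result is the name of the element that the algorithm announces.
\<close>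

definition announced_element :: "nat \<Rightarrow> real \<Rightarrow> nat rel \<Rightarrow> rand_alg \<Rightarrow> nat pmf" where
  "announced_element n \<gamma> r A =
     bind_pmf (pmf_of_set (permutations_of_set {..<n})) (\<lambda>xs.
     bind_pmf A (\<lambda>t.
     map_pmf (\<lambda>i. xs ! i) (run_tree \<gamma> (\<lambda>i j. (xs ! i, xs ! j) \<in> r) t)))"

definition minimum_elements :: "nat \<Rightarrow> nat rel \<Rightarrow> nat set" where
  "minimum_elements n r = {x \<in> {..<n}. \<forall>y \<in> {..<n}. (x, y) \<in> r}"

definition findmin_success :: "nat \<Rightarrow> real \<Rightarrow> nat rel \<Rightarrow> rand_alg \<Rightarrow> real" where
  "findmin_success n \<gamma> r A =
     measure_pmf.prob (announced_element n \<gamma> r A) (minimum_elements n r)"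

end

theory Submission
  imports Defs
begin

text \<open>
  The algorithm is a knock-out tournament in which a match between two winners of height \<open>d\<close> is
  decided by a majority vote over \<open>(2 * d + 1) * k\<close> comparisons, where \<open>k = \<lfloor>c / \<gamma>\<^sup>2\<rfloor>\<close>.  Matches become
  geometrically rarer with the height, so the total cost is at most \<open>3 * n * k\<close>.  The announced
  element is wrong only if the minimum loses one of its own matches; by a Chernoff bound this has
  probability at most \<open>x ^ (2 * d + 1)\<close> at height \<open>d\<close>, where \<open>x = (1 - \<gamma>\<^sup>2 / 2) ^ k\<close> is exponentially
  small in \<open>c\<close>, and these bounds sum to at most \<open>2 * x\<close>.
\<close>

section \<open>Sequential composition of decision trees\<close>

primrec leaves :: "comp_tree \<Rightarrow> nat set" where
  "leaves (Output i) = {i}"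
| "leaves (Query i j k) = leaves (k True) \<union> leaves (k False)"

primrec bind_tree :: "comp_tree \<Rightarrow> (nat \<Rightarrow> comp_tree) \<Rightarrow> comp_tree" where
  "bind_tree (Output i) f = f i"
| "bind_tree (Query i j k) f = Query i j (\<lambda>b. bind_tree (k b) f)"

lemma leaves_Query_subset: "leaves (k b) \<subseteq> leaves (Query i j k)"
  by (cases b) auto

lemma leaves_bind_tree: "leaves (bind_tree t f) = (\<Union>i\<in>leaves t. leaves (f i))"
  by (induction t) auto

lemma valid_bind_tree:
  "valid_tree n t \<Longrightarrow> (\<And>i. i \<in> leaves t \<Longrightarrow> valid_tree n (f i)) \<Longrightarrow> valid_tree n (bind_tree t f)"
proof (induction t)
  case (Query i j k)
  have "valid_tree n (bind_tree (k b) f)" for b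
    using Query leaves_Query_subset[of k b i j] by (intro Query.IH) auto
  then show ?case using Query.prems by simp
qed simp

lemma num_queries_bind_tree:
  "(\<And>i. num_queries (f i) \<le> q) \<Longrightarrow> num_queries (bind_tree t f) \<le> num_queries t + q"
proof (induction t)
  case (Query i j k)
  have "num_queries (bind_tree (k b) f) \<le> num_queries (k b) + q" for b
    using Query by blast
  from this[of True] this[of False] show ?case by (auto simp: max_def)
qed simp

lemma run_bind_tree:
  "run_tree \<gamma> le (bind_tree t f) = bind_pmf (run_tree \<gamma> le t) (\<lambda>i. run_tree \<gamma> le (f i))"
  by (induction t) (auto simp: bind_return_pmf bind_assoc_pmf intro!: bind_pmf_cong)

lemma set_run_tree: "set_pmf (run_tree \<gamma> le t) \<subseteq> leaves t"
proof (induction t)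
  case (Query i j k)
  then show ?case using leaves_Query_subset[of k _ i j] by fastforce
qed simp

section \<open>Error probability of a two-stage experiment\<close>

lemma prob_bind_pmf_integral:
  "measure_pmf.prob (bind_pmf M f) A = measure_pmf.expectation M (\<lambda>x. measure_pmf.prob (f x) A)"
proof -
  have "ennreal (measure_pmf.prob (bind_pmf M f) A) =
      (\<integral>\<^sup>+ x. ennreal (measure_pmf.prob (f x) A) \<partial>measure_pmf M)"
    by (simp add: measure_pmf.emeasure_eq_measure [symmetric])
  also have "\<dots> = ennreal (measure_pmf.expectation M (\<lambda>x. measure_pmf.prob (f x) A))"
    by (intro nn_integral_eq_integral measure_pmf.integrable_const_bound[where B = 1]) auto
  finally show ?thesis
    by (simp add: integral_nonneg_AE)
qed

text \<open>Union bound: either the first stage lands in the bad set \<open>B\<close>, or the second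
  stage fails from a good value. With \<open>B = {}\<close> it averages a uniform bound.\<close>

lemma prob_bind_pmf_le:
  assumes e: "\<And>x. x \<in> set_pmf M \<Longrightarrow> x \<notin> B \<Longrightarrow> measure_pmf.prob (f x) A \<le> e" and "0 \<le> e"
  shows "measure_pmf.prob (bind_pmf M f) A \<le> measure_pmf.prob M B + e"
proof -
  have "measure_pmf.prob (bind_pmf M f) A \<le> measure_pmf.expectation M (\<lambda>x. indicator B x + e)"
    unfolding prob_bind_pmf_integral
  proof (rule integral_mono_AE)
    show "integrable (measure_pmf M) (\<lambda>x. measure_pmf.prob (f x) A)"
      by (intro measure_pmf.integrable_const_bound[where B = 1]) auto
    show "integrable (measure_pmf M) (\<lambda>x. indicator B x + e)"
      by (intro measure_pmf.integrable_const_bound[where B = "1 + e"])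
         (use \<open>0 \<le> e\<close> in \<open>auto simp: indicator_def\<close>)
    have "measure_pmf.prob (f x) A \<le> indicator B x + e" if "x \<in> set_pmf M" for x
      using e[OF that] \<open>0 \<le> e\<close>
      by (cases "x \<in> B") (auto intro: order_trans[OF measure_pmf.prob_le_1])
    then show "AE x in measure_pmf M. measure_pmf.prob (f x) A \<le> indicator B x + e"
      by (simp add: AE_measure_pmf_iff)
  qed
  also have "\<dots> = measure_pmf.prob M B + e"
    by (subst Bochner_Integration.integral_add)
       (auto intro!: measure_pmf.integrable_const_bound[where B = 1] simp: indicator_def)
  finally show ?thesis .
qed

section \<open>Majority vote between two positions\<close>

lemma expectation_noisy_answer:
  fixes f :: "bool \<Rightarrow> real"
  assumes "0 < \<gamma>" "\<gamma> \<le> 1"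
  shows "measure_pmf.expectation (noisy_answer \<gamma> b) f =
    (1 + \<gamma>) / 2 * f b + (1 - \<gamma>) / 2 * f (\<not> b)"
  using assms by (simp add: noisy_answer_def field_simps)

text \<open>\<open>s\<close> is the current lead of \<open>i\<close> over \<open>j\<close> in votes.
  It is a parameter, not fixed at \<open>0\<close>, so that the error bound can be proved by
  induction on the votes left. A tie goes to \<open>j\<close>.\<close>

primrec duel :: "nat \<Rightarrow> int \<Rightarrow> nat \<Rightarrow> nat \<Rightarrow> comp_tree" where
  "duel 0 s i j = Output (if s > 0 then i else j)"
| "duel (Suc m) s i j = Query i j (\<lambda>b. duel m (s + (if b then 1 else - 1)) i j)"

lemma leaves_duel: "leaves (duel m s i j) \<subseteq> {i, j}"
  by (induction m arbitrary: s) auto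

lemma valid_duel: "i < n \<Longrightarrow> j < n \<Longrightarrow> i \<noteq> j \<Longrightarrow> valid_tree n (duel m s i j)"
  by (induction m arbitrary: s) auto

lemma num_queries_duel: "num_queries (duel m s i j) = m"
  by (induction m arbitrary: s) auto

text \<open>
  The Chernoff bound with base \<open>1 + \<gamma>\<close>: multiplied out, a step towards the correct answer contributes
  \<open>(1 + \<gamma>) / 2 / (1 + \<gamma>) = 1 / 2\<close> and a step away from it \<open>(1 - \<gamma>) / 2 * (1 + \<gamma>)\<close>, which add up
  to \<open>1 - \<gamma>\<^sup>2 / 2\<close>.
\<close>

lemma prob_duel_wrong:
  assumes \<gamma>: "0 < \<gamma>" "\<gamma> \<le> 1" and "i \<noteq> j"
  shows "measure_pmf.prob (run_tree \<gamma> le (duel m s i j)) (- {if le i j then i else j})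
    \<le> (1 + \<gamma>) powi (if le i j then - s else s) * (1 - \<gamma>\<^sup>2 / 2) ^ m"
proof (induction m arbitrary: s)
  case 0
  \<comment> \<open>A wrong final verdict forces a nonnegative exponent (zero only after a tie), so
    the bound is at least 1; a right verdict has error probability 0.\<close>
  have "1 \<le> (1 + \<gamma>) powi t" if "0 \<le> t" for t
    using \<gamma> that by (simp add: power_int_def)
  moreover have "0 \<le> (1 + \<gamma>) powi t" for t
    using \<gamma> by simp
  ultimately show ?case using \<open>i \<noteq> j\<close> by (auto simp: indicator_def)
next
  case (Suc m)
  let ?W = "- {if le i j then i else j}"
  let ?e = "\<lambda>s. (1 + \<gamma>) powi (if le i j then - s else s)"
  define \<sigma> :: int where "\<sigma> = (if le i j then 1 else - 1)"
  have up: "?e (s + \<sigma>) = ?e s / (1 + \<gamma>)" and down: "?e (s - \<sigma>) = ?e s * (1 + \<gamma>)"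
    using \<gamma> by (auto simp: \<sigma>_def power_int_add power_int_diff power_int_minus divide_simps)
  let ?P = "\<lambda>s. measure_pmf.prob (run_tree \<gamma> le (duel m s i j)) ?W"
  have "measure_pmf.prob (run_tree \<gamma> le (duel (Suc m) s i j)) ?W =
      (1 + \<gamma>) / 2 * ?P (s + \<sigma>) + (1 - \<gamma>) / 2 * ?P (s - \<sigma>)"
    by (simp add: prob_bind_pmf_integral expectation_noisy_answer[OF \<gamma>] \<sigma>_def)
  also have "\<dots> \<le> (1 + \<gamma>) / 2 * (?e (s + \<sigma>) * (1 - \<gamma>\<^sup>2 / 2) ^ m)
      + (1 - \<gamma>) / 2 * (?e (s - \<sigma>) * (1 - \<gamma>\<^sup>2 / 2) ^ m)"
    using \<gamma> by (intro add_mono mult_left_mono Suc.IH) auto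
  also have "\<dots> = ?e s * (1 - \<gamma>\<^sup>2 / 2) ^ Suc m"
  proof -
    have "(1 + \<gamma>) / 2 * (E / (1 + \<gamma>) * R) + (1 - \<gamma>) / 2 * (E * (1 + \<gamma>) * R)
        = E * ((1 - \<gamma>\<^sup>2 / 2) * R)" for E R :: real
      using \<gamma> by (simp add: power2_eq_square field_simps)
    then show ?thesis unfolding up down power_Suc .
  qed
  finally show ?case .
qed

section \<open>The tournament: validity, cost and error\<close>

text \<open>A bracket of height \<open>d\<close> covers the positions from \<open>l\<close> below
  \<open>min n (l + 2 ^ d)\<close>. If its right half would be empty, the left winner gets a bye, so
  \<open>n\<close> need not be a power of two.\<close>

primrec tournament :: "nat \<Rightarrow> nat \<Rightarrow> nat \<Rightarrow> nat \<Rightarrow> comp_tree" where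
  "tournament k n 0 l = Output l"
| "tournament k n (Suc d) l =
     (if n \<le> l + 2 ^ d then tournament k n d l
      else bind_tree (tournament k n d l) (\<lambda>i.
           bind_tree (tournament k n d (l + 2 ^ d)) (\<lambda>j. duel ((2 * d + 1) * k) 0 i j)))"

text \<open>The two halves announce positions from disjoint intervals. Hence finalists always
  differ, which both \<open>valid_tree\<close> and the error bound for a duel require.\<close>

lemma leaves_tournament:
  "l < n \<Longrightarrow> leaves (tournament k n d l) \<subseteq> {l..<min n (l + 2 ^ d)}"
proof (induction d arbitrary: l)
  case (Suc d)
  show ?case
  proof (cases "n \<le> l + 2 ^ d")
    case True
    then show ?thesis using Suc.IH[OF Suc.prems] by auto
  next
    case False
    then have "l + 2 ^ d < n" by simp
    have "leaves (tournament k n (Suc d) l)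
        \<subseteq> leaves (tournament k n d l) \<union> leaves (tournament k n d (l + 2 ^ d))"
      using leaves_duel False by (fastforce simp: leaves_bind_tree)
    also have "\<dots> \<subseteq> {l..<min n (l + 2 ^ Suc d)}"
      using Suc.IH[OF Suc.prems] Suc.IH[OF \<open>l + 2 ^ d < n\<close>] by force
    finally show ?thesis .
  qed
qed simp

lemma valid_tournament: "l < n \<Longrightarrow> valid_tree n (tournament k n d l)"
proof (induction d arbitrary: l)
  case (Suc d)
  show ?case
  proof (cases "n \<le> l + 2 ^ d")
    case False
    then have r: "l + 2 ^ d < n" by simp
    have "valid_tree n (duel ((2 * d + 1) * k) 0 i j)"
      if "i \<in> leaves (tournament k n d l)" "j \<in> leaves (tournament k n d (l + 2 ^ d))" for i j
      using that leaves_tournament[OF Suc.prems, of k d] leaves_tournament[OF r, of k d]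
      by (intro valid_duel) force+
    then show ?thesis
      using False Suc.IH[OF Suc.prems] Suc.IH[OF r] by (auto intro!: valid_bind_tree)
  qed (use Suc in auto)
qed simp

text \<open>
  The sharper bound for full brackets, an exact count, absorbs the final match of a partial one.
\<close>

lemma num_queries_tournament_full:
  "l + 2 ^ d \<le> n \<Longrightarrow> num_queries (tournament k n d l) + (2 * d + 3) * k \<le> 3 * 2 ^ d * k"
proof (induction d arbitrary: l)
  case (Suc d)
  have "num_queries (tournament k n (Suc d) l)
      \<le> num_queries (tournament k n d l)
        + (num_queries (tournament k n d (l + 2 ^ d)) + (2 * d + 1) * k)"
    by (auto intro!: num_queries_bind_tree simp: num_queries_duel)
  \<comment> \<open>In units of \<open>k\<close>, twice the slack \<open>2 * d + 3\<close> minus the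
    match \<open>2 * d + 1\<close> leaves \<open>2 * d + 5\<close>, the slack one level up.\<close>
  then show ?case
    using Suc.IH[of l] Suc.IH[of "l + 2 ^ d"] Suc.prems by (simp add: algebra_simps)
qed simp

text \<open>A match is played only when the left half is full. The slack there pays for the match,
  and the possibly partial right half is charged by induction.\<close>

lemma num_queries_tournament:
  "l < n \<Longrightarrow> num_queries (tournament k n d l) \<le> 3 * (n - l) * k"
proof (induction d arbitrary: l)
  case (Suc d)
  show ?case
  proof (cases "n \<le> l + 2 ^ d")
    case False
    then have r: "l + 2 ^ d < n" by simp
    then obtain e where e: "n = l + 2 ^ d + e" using le_Suc_ex less_imp_le by blast
    have "num_queries (tournament k n (Suc d) l)
        \<le> num_queries (tournament k n d l)
          + (num_queries (tournament k n d (l + 2 ^ d)) + (2 * d + 1) * k)"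
      by (auto intro!: num_queries_bind_tree simp: num_queries_duel)
    then show ?thesis
      using num_queries_tournament_full[of l d n k] Suc.IH[OF r] r
      by (simp add: e algebra_simps)
  qed (use Suc in auto)
qed simp

text \<open>Induction along the branch of \<open>a\<close>: either its own half fails to announce
  \<open>a\<close>, or \<open>a\<close> loses the final. The winner of the other half may be
  arbitrary, since the duel bound holds against every opponent.\<close>

lemma prob_tournament_wrong:
  assumes \<gamma>: "0 < \<gamma>" "\<gamma> \<le> 1"
    and "a < n" and min: "\<And>j. j < n \<Longrightarrow> j \<noteq> a \<Longrightarrow> le a j \<and> \<not> le j a"
  shows "a \<in> {l..<l + 2 ^ d} \<Longrightarrow>
    measure_pmf.prob (run_tree \<gamma> le (tournament k n d l)) (- {a})
      \<le> (\<Sum>h<d. (1 - \<gamma>\<^sup>2 / 2) ^ ((2 * h + 1) * k))"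
proof (induction d arbitrary: l)
  case 0
  then show ?case by simp
next
  case (Suc d)
  let ?e = "\<lambda>h. (1 - \<gamma>\<^sup>2 / 2) ^ ((2 * h + 1) * k)"
  have "\<gamma>\<^sup>2 \<le> 1" using \<gamma> by (simp add: power_le_one)
  then have e0: "0 \<le> ?e h" for h by simp
  have l: "l < n" using Suc.prems \<open>a < n\<close> by simp
  show ?case
  proof (cases "n \<le> l + 2 ^ d")
    case True
    \<comment> \<open>A bye: no match is played, and the extra summand is nonnegative.\<close>
    then show ?thesis using Suc \<open>a < n\<close> e0[of d] by force
  next
    case False
    then have r: "l + 2 ^ d < n" by simp
    let ?L = "run_tree \<gamma> le (tournament k n d l)"
      and ?R = "run_tree \<gamma> le (tournament k n d (l + 2 ^ d))"
      and ?D = "\<lambda>i j. run_tree \<gamma> le (duel ((2 * d + 1) * k) 0 i j)"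
    have L: "set_pmf ?L \<subseteq> {l..<l + 2 ^ d}"
      using set_run_tree[of \<gamma> le "tournament k n d l"] leaves_tournament[OF l, of k d] r
      by (meson dual_order.trans min.cobounded2 order_refl ivl_subset)
    have R: "set_pmf ?R \<subseteq> {l + 2 ^ d..<n}"
      using set_run_tree[of \<gamma> le "tournament k n d (l + 2 ^ d)"] leaves_tournament[OF r, of k d]
      by fastforce
    have left: "measure_pmf.prob (?D a j) (- {a}) \<le> ?e d" if "j < n" "j \<noteq> a" for j
      using prob_duel_wrong[OF \<gamma>, of a j le "(2 * d + 1) * k" 0] min[OF that] that by auto
    have right: "measure_pmf.prob (?D i a) (- {a}) \<le> ?e d" if "i < n" "i \<noteq> a" for i
      using prob_duel_wrong[OF \<gamma>, of i a le "(2 * d + 1) * k" 0] min[OF that] that by auto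
    have run: "run_tree \<gamma> le (tournament k n (Suc d) l) =
        bind_pmf ?L (\<lambda>i. bind_pmf ?R (\<lambda>j. ?D i j))"
      using False by (simp add: run_bind_tree)
    show ?thesis
    proof (cases "a < l + 2 ^ d")
      case True
      \<comment> \<open>No value of \<open>?R\<close> is bad: every opponent lies in the right half
        and so differs from \<open>a\<close>.\<close>
      have "measure_pmf.prob (bind_pmf ?R (?D a)) (- {a}) \<le> measure_pmf.prob ?R {} + ?e d"
        using R True by (intro prob_bind_pmf_le left e0) auto
      then have "measure_pmf.prob (run_tree \<gamma> le (tournament k n (Suc d) l)) (- {a})
          \<le> measure_pmf.prob ?L (- {a}) + ?e d"
        unfolding run by (intro prob_bind_pmf_le e0) auto
      then show ?thesis using Suc.IH[of l] True Suc.prems by simp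
    next
      case False
      \<comment> \<open>Mirror image: now the bad event sits in the second stage \<open>?R\<close>,
        and the bad set for \<open>?L\<close> is empty.\<close>
      have "measure_pmf.prob (bind_pmf ?R (?D i)) (- {a}) \<le> measure_pmf.prob ?R (- {a}) + ?e d"
        if "i \<in> set_pmf ?L" for i
      proof (rule prob_bind_pmf_le)
        show "measure_pmf.prob (?D i j) (- {a}) \<le> ?e d" if "j \<notin> - {a}" for j
          using right[of i] \<open>i \<in> set_pmf ?L\<close> L False r that by force
      qed (rule e0)
      then have "measure_pmf.prob (run_tree \<gamma> le (tournament k n (Suc d) l)) (- {a})
          \<le> measure_pmf.prob ?L {} + (measure_pmf.prob ?R (- {a}) + ?e d)"
        unfolding run by (intro prob_bind_pmf_le[where B = "{}"] add_nonneg_nonneg e0) simp_all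
      then show ?thesis using Suc.IH[of "l + 2 ^ d"] False Suc.prems by simp
    qed
  qed
qed

section \<open>Geometric sum, least element and error exponent\<close>

lemma sum_odd_powers_le:
  fixes x :: real
  assumes "0 \<le> x" "x \<le> 1 / 2"
  shows "(\<Sum>h<d. x ^ (2 * h + 1)) \<le> 2 * x"
proof -
  have "x\<^sup>2 \<le> (1 / 2)\<^sup>2" using assms by (intro power_mono) auto
  then have "x\<^sup>2 \<le> 1 / 2" by (simp add: power2_eq_square)
  have "(\<Sum>h<d. x ^ (2 * h + 1)) = x * (\<Sum>h<d. (x\<^sup>2) ^ h)"
    by (simp add: sum_distrib_left power_mult)
  also have "\<dots> \<le> x * (\<Sum>h<d. (1 / 2) ^ h)"
    using assms \<open>x\<^sup>2 \<le> 1 / 2\<close> by (intro mult_left_mono sum_mono power_mono) auto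
  also have "\<dots> \<le> x * 2"
    using assms by (intro mult_left_mono) (auto simp: sum_gp_strict)
  finally show ?thesis by simp
qed

text \<open>The order is an arbitrary relation on the names, so \<open>Min\<close> for the natural
  numbers would give the wrong element.\<close>

lemma finite_linear_order_least:
  assumes "linear_order_on A r" "finite A" "A \<noteq> {}"
  obtains x where "x \<in> A" "\<And>y. y \<in> A \<Longrightarrow> (x, y) \<in> r"
proof -
  have "\<exists>x\<in>B. \<forall>y\<in>B. (x, y) \<in> r" if "finite B" "B \<noteq> {}" "B \<subseteq> A" for B
    using that
  proof (induction B rule: finite_ne_induct)
    case (singleton x)
    then show ?case using assms(1) by (auto simp: order_on_defs refl_on_def)
  next
    case (insert z B)
    then obtain x where x: "x \<in> B" "\<forall>y\<in>B. (x, y) \<in> r" by auto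
    have r: "total_on A r" "trans r" "(z, z) \<in> r"
      using assms(1) insert.prems by (auto simp: order_on_defs refl_on_def)
    show ?case
    proof (cases "(x, z) \<in> r")
      case False
      then have "(z, x) \<in> r"
        using r insert.prems x(1) by (metis insert_subset subsetD total_on_def)
      then show ?thesis
        using x(1) r(3) transD[OF r(2) \<open>(z, x) \<in> r\<close>] x(2) by blast
    qed (use x in auto)
  qed
  from this[OF assms(2,3) order_refl] that show ?thesis by blast
qed

lemma prob_vote_wrong_le:
  fixes c \<gamma> :: real
  assumes "10 \<le> c" and \<gamma>: "0 < \<gamma>" "\<gamma> \<le> 1"
  defines "x \<equiv> (1 - \<gamma>\<^sup>2 / 2) ^ nat \<lfloor>c / \<gamma>\<^sup>2\<rfloor>"
  shows "0 \<le> x" "x \<le> 1 / 2" "2 * x \<le> exp (- (1 / 4) * c)"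
proof -
  have \<gamma>2: "0 < \<gamma>\<^sup>2" "\<gamma>\<^sup>2 \<le> 1" using \<gamma> by (auto simp: power_le_one)
  then show "0 \<le> x" by (simp add: x_def)
  have "0 \<le> c / \<gamma>\<^sup>2" using \<open>10 \<le> c\<close> \<gamma>2 by simp
  then have "c / \<gamma>\<^sup>2 - 1 \<le> real (nat \<lfloor>c / \<gamma>\<^sup>2\<rfloor>)" by linarith
  then have "(c / \<gamma>\<^sup>2 - 1) * \<gamma>\<^sup>2 \<le> real (nat \<lfloor>c / \<gamma>\<^sup>2\<rfloor>) * \<gamma>\<^sup>2"
    using \<gamma>2 by (intro mult_right_mono) auto
  \<comment> \<open>Rounding \<open>k\<close> down costs at most
    \<open>\<gamma>\<^sup>2 \<le> 1 \<le> c / 10\<close>.\<close>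
  moreover have "9 / 10 * c \<le> (c / \<gamma>\<^sup>2 - 1) * \<gamma>\<^sup>2"
    using \<open>10 \<le> c\<close> \<gamma>2 by (simp add: left_diff_distrib)
  ultimately have k: "9 / 10 * c \<le> real (nat \<lfloor>c / \<gamma>\<^sup>2\<rfloor>) * \<gamma>\<^sup>2"
    by (rule order_trans[rotated])
  have "x \<le> exp (- \<gamma>\<^sup>2 / 2) ^ nat \<lfloor>c / \<gamma>\<^sup>2\<rfloor>"
    unfolding x_def using \<gamma>2 exp_ge_add_one_self[of "- \<gamma>\<^sup>2 / 2"] by (intro power_mono) auto
  also have "\<dots> \<le> exp (- (9 / 20) * c)"
    using k by (simp flip: exp_of_nat_mult)
  finally have x: "x \<le> exp (- (9 / 20) * c)" .
  \<comment> \<open>The factor 2 is absorbed by giving up \<open>c / 5\<close> in the exponent: 9/20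
    - 1/5 = 1/4, the final constant.\<close>
  have "1 + c / 5 \<le> exp (c / 5)" by simp
  then have "2 \<le> exp (c / 5)" using \<open>10 \<le> c\<close> by linarith
  then have "2 * exp (- (9 / 20) * c) \<le> exp (c / 5) * exp (- (9 / 20) * c)"
    by (intro mult_right_mono) auto
  also have "\<dots> = exp (- (1 / 4) * c)" by (simp flip: exp_add)
  finally show x2: "2 * x \<le> exp (- (1 / 4) * c)" using x by linarith
  moreover have "exp (- (1 / 4) * c) \<le> 1" using \<open>10 \<le> c\<close> by simp
  ultimately show "x \<le> 1 / 2" by linarith
qed

section \<open>Success probability and the final algorithm\<close>

lemma findmin_success_tournament:
  assumes "0 < n" "linear_order_on {..<n} r" and c: "10 \<le> c" and \<gamma>: "0 < \<gamma>" "\<gamma> \<le> 1"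
  defines "A \<equiv> return_pmf (tournament (nat \<lfloor>c / \<gamma>\<^sup>2\<rfloor>) n n 0)"
  shows "1 - exp (- (1 / 4) * c) \<le> findmin_success n \<gamma> r A"
proof -
  let ?k = "nat \<lfloor>c / \<gamma>\<^sup>2\<rfloor>"
  let ?x = "(1 - \<gamma>\<^sup>2 / 2) ^ ?k"
  let ?le = "\<lambda>xs i j. (xs ! i, xs ! j) \<in> r"
  let ?out = "\<lambda>xs. map_pmf ((!) xs) (run_tree \<gamma> (?le xs) (tournament ?k n n 0))"
  let ?M = "minimum_elements n r"
  have "{..<n} \<noteq> {}" using \<open>0 < n\<close> by auto
  then obtain m where m: "m < n" "\<And>y. y < n \<Longrightarrow> (m, y) \<in> r"
    using finite_linear_order_least[OF assms(2)] by (metis finite_lessThan lessThan_iff)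
  \<comment> \<open>The bound is shown for each arrangement \<open>xs\<close> separately and
    averaged over the random order afterwards.\<close>
  have wrong: "measure_pmf.prob (?out xs) (- ?M) \<le> exp (- (1 / 4) * c)"
    if "xs \<in> permutations_of_set {..<n}" for xs
  proof -
    have xs: "set xs = {..<n}" "distinct xs"
      using that by (auto dest: permutations_of_setD)
    then have len: "length xs = n" using distinct_card by fastforce
    obtain a where a: "a < n" "xs ! a = m"
      using m(1) xs(1) len by (metis in_set_conv_nth lessThan_iff)
    have min: "?le xs a j \<and> \<not> ?le xs j a" if "j < n" "j \<noteq> a" for j
    proof -
      have "xs ! j < n" "xs ! j \<noteq> m"
        using that a xs len by (metis nth_mem lessThan_iff, metis nth_eq_iff_index_eq)
      then show ?thesis
        using m(2)[of "xs ! j"] a(2) assms(2) by (auto simp: order_on_defs dest: antisymD)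
    qed
    \<comment> \<open>Height \<open>n\<close> is a crude choice that covers all positions; the
      surplus levels are byes and cost no comparisons.\<close>
    have "a < 2 ^ n" using a(1) by (meson less_exp less_trans)
    have "measure_pmf.prob (?out xs) (- ?M)
        \<le> measure_pmf.prob (run_tree \<gamma> (?le xs) (tournament ?k n n 0)) (- {a})"
      unfolding measure_map_pmf
      using a m by (intro measure_pmf.finite_measure_mono) (auto simp: minimum_elements_def)
    also have "\<dots> \<le> (\<Sum>h<n. (1 - \<gamma>\<^sup>2 / 2) ^ ((2 * h + 1) * ?k))"
      using prob_tournament_wrong[where le = "?le xs", OF \<gamma> a(1) min] \<open>a < 2 ^ n\<close> by simp
    also have "\<dots> = (\<Sum>h<n. ?x ^ (2 * h + 1))"
      by (intro sum.cong refl) (metis power_mult mult.commute)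
    also have "\<dots> \<le> 2 * ?x"
      using prob_vote_wrong_le[OF c \<gamma>] by (intro sum_odd_powers_le)
    also have "\<dots> \<le> exp (- (1 / 4) * c)"
      using prob_vote_wrong_le[OF c \<gamma>] by blast
    finally show ?thesis .
  qed
  have "measure_pmf.prob (announced_element n \<gamma> r A) (- ?M)
      \<le> measure_pmf.prob (pmf_of_set (permutations_of_set {..<n})) {} + exp (- (1 / 4) * c)"
    unfolding announced_element_def A_def bind_return_pmf
    by (intro prob_bind_pmf_le wrong) auto
  moreover have "measure_pmf.prob (announced_element n \<gamma> r A) (- ?M) = 1 - findmin_success n \<gamma> r A"
    unfolding findmin_success_def
    using measure_pmf.prob_compl[of ?M "announced_element n \<gamma> r A"] by (simp add: Compl_eq_Diff_UNIV)
  ultimately show ?thesis by simp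
qed

theorem theorem12:
  "\<exists>\<delta>::real. \<delta> > 0 \<and> (\<exists>n\<^sub>0::nat. \<forall>n\<ge>n\<^sub>0. \<forall>c \<gamma> :: real.
     10 \<le> c \<and> c \<le> log 2 (real n) \<and> 0 < \<gamma> \<and> \<gamma> \<le> 1 \<longrightarrow>
     (\<exists>A. comparison_algorithm n A \<and>
          query_complexity_le A (3 * c * real n / \<gamma>\<^sup>2) \<and>
          (\<forall>r. linear_order_on {..<n} r \<longrightarrow>
               findmin_success n \<gamma> r A \<ge> 1 - exp (- \<delta> * c))))"
proof (intro exI[of _ "1 / 4 :: real"] conjI exI[of _ "1 :: nat"] allI impI; (elim conjE)?)
  fix n :: nat and c \<gamma> :: real
  assume "1 \<le> n" and c: "10 \<le> c" and \<gamma>: "0 < \<gamma>" "\<gamma> \<le> 1"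
  then have "0 < n" by simp
  let ?k = "nat \<lfloor>c / \<gamma>\<^sup>2\<rfloor>"
  let ?t = "tournament ?k n n 0"
  have "real (num_queries ?t) \<le> real (3 * n * ?k)"
    using num_queries_tournament[OF \<open>0 < n\<close>] by (metis diff_zero of_nat_mono)
  also have "\<dots> = 3 * real n * real ?k" by simp
  \<comment> \<open>Rounding \<open>k\<close> down, not up, keeps the cost within the exact
    budget.\<close>
  also have "\<dots> \<le> 3 * real n * (c / \<gamma>\<^sup>2)"
    using c by (intro mult_left_mono) auto
  finally have "query_complexity_le (return_pmf ?t) (3 * c * real n / \<gamma>\<^sup>2)"
    by (simp add: query_complexity_le_def mult_ac)
  moreover have "comparison_algorithm n (return_pmf ?t)"
    using valid_tournament[OF \<open>0 < n\<close>] by (simp add: comparison_algorithm_def)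
  ultimately show "\<exists>A. comparison_algorithm n A \<and>
      query_complexity_le A (3 * c * real n / \<gamma>\<^sup>2) \<and>
      (\<forall>r. linear_order_on {..<n} r \<longrightarrow>
           findmin_success n \<gamma> r A \<ge> 1 - exp (- (1 / 4) * c))"
    using findmin_success_tournament[OF \<open>0 < n\<close> _ c \<gamma>] by blast
qed simp

end
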